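(* Consider the single-server queue with deterministic service time $T=1$ fed by the pre-scheduled random arrivals process with $\lambda=1$ (so traffic intensity $\varrho=1$), whose delays have a density vanishing outside $[-L,L]$, $L\in\mathbb{N}$. Let $n(j)$ be the queue length immediately before the service at time $j$, let $I_j\subset\{j-L+1,\dots,j+L-1\}$ be the set of customers with indices in that range who have already arrived at time $j$, and let $m(j)$ be the number of arrivals in $[j,j+1)$. Then, almost surely, for all $j$, $$m(j)=|I_{j+1}|-|I_j|+1,\qquad n(j+1)=n(j)+|I_{j+1}|-|I_j|+\delta_{n(j),0}.$$ Hence the quantity $\alpha(j)=n(j)-|I_j|$ satisfies $\alpha(j+1)=\alpha(j)+\delta_{n(j),0}$: it is constant during a busy period and increases by $1$ at the end of each busy period. Consequently the stationary distribution is reached once $\alpha>0$, and: (a) If the initial value of $\alpha$ is strictly positive, the value $n(j)=0$ is never realized, $\alpha$ remains constant, and the average queue length is $N=E(n)=\alpha+E(|I|)$. (b) If the initial value of $\alpha$ is $0$ or negative, a sequence of busy periods is realized, giving in the end the value $\alpha=1$, and the (stationary) expected queue length is $N=E(n)=1+E(|I|)$. (c) Once the stationary value $\alpha>0$ is reached, the probability distribution of $n$ is $P_k=P(n=k)=P(|I|=k-\alpha)$; in particular only values $k\ge\alpha$ occur. Here $|I|$ denotes a random variable with the common distribution of the $|I_j|$. In particular, for $\varrho=1$ the system has a finite average queue length, and the stationary problem is completely solved for every initial condition.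
   Context: Pre-scheduled random arrivals with $\lambda=1$: customer $i\in\mathbb{Z}$ arrives at time $t_i=i+\xi_i$, where the $\xi_i$ are i.i.d. real random variables with mean $0$, variance $\sigma^2$ and a continuous probability density $f$ satisfying $f(t)=0$ for $|t|>L$. Thus at the discrete time $j$ every customer $i\le j-L$ has certainly arrived and every customer $i\ge j+L$ has certainly not yet arrived. $I_j=\{i\in\{j-L+1,\dots,j+L-1\}: t_i<j\}$ (these customers may be waiting or already served), so $0\le|I_j|\le 2L-1$, and the distribution of $|I_j|$ does not depend on $j$. The queue length is a nonnegative-integer-valued process obeying $n(j+1)=n(j)-(1-\delta_{n(j),0})+m(j)$, where $\delta$ is the Kronecker delta: at time $j$ one customer is served if the queue is nonempty, and if $n(j)=0$ then $n(j+1)=m(j)$. A busy period is a stretch of times between consecutive times $j$ at which $n(j)=0$.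
   Formalization: For initial α ≤ 0, as in (b), it is also assumed that the density is not identically zero on (L-1, L]; otherwise |I_j| ≥ 1 almost surely for all j, so α can never rise above 0 and (b) fails (e.g. L = 3, density supported in [-0.4, 0.4]). *)

theory Defs
  imports "HOL-Probability.Probability"
begin

text \<open>
  Pre-scheduled random arrivals with \<open>\<lambda> = 1\<close>: customer \<open>i\<close> arrives at time \<open>i + \<xi> i\<close>.
\<close>

definition arrival_time :: "(int \<Rightarrow> 'a \<Rightarrow> real) \<Rightarrow> int \<Rightarrow> 'a \<Rightarrow> real" where
  "arrival_time \<xi> i \<omega> = real_of_int i + \<xi> i \<omega>"

definition arrived :: "(int \<Rightarrow> 'a \<Rightarrow> real) \<Rightarrow> nat \<Rightarrow> int \<Rightarrow> 'a \<Rightarrow> int set" where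
  "arrived \<xi> L j \<omega> =
     {i \<in> {j - int L + 1 .. j + int L - 1}. arrival_time \<xi> i \<omega> < real_of_int j}"

definition arrivals :: "(int \<Rightarrow> 'a \<Rightarrow> real) \<Rightarrow> int \<Rightarrow> 'a \<Rightarrow> int set" where
  "arrivals \<xi> j \<omega> =
     {i. real_of_int j \<le> arrival_time \<xi> i \<omega> \<and> arrival_time \<xi> i \<omega> < real_of_int (j + 1)}"

abbreviation num_arrived :: "(int \<Rightarrow> 'a \<Rightarrow> real) \<Rightarrow> nat \<Rightarrow> int \<Rightarrow> 'a \<Rightarrow> nat" where
  "num_arrived \<xi> L j \<omega> \<equiv> card (arrived \<xi> L j \<omega>)"

abbreviation num_arrivals :: "(int \<Rightarrow> 'a \<Rightarrow> real) \<Rightarrow> int \<Rightarrow> 'a \<Rightarrow> nat" where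
  "num_arrivals \<xi> j \<omega> \<equiv> card (arrivals \<xi> j \<omega>)"

text \<open>
  The process is observed from the initial time \<open>j0\<close> on. The initial length \<open>n j0\<close> is an
  arbitrary random variable, possibly dependent on the delays; \<open>of_bool (n j \<omega> = 0)\<close> is the
  Kronecker delta.
\<close>

definition queue_process ::
    "'a measure \<Rightarrow> (int \<Rightarrow> 'a \<Rightarrow> real) \<Rightarrow> int \<Rightarrow> (int \<Rightarrow> 'a \<Rightarrow> nat) \<Rightarrow> bool" where
  "queue_process M \<xi> j0 n \<longleftrightarrow>
     (\<forall>j\<ge>j0. n j \<in> measurable M (count_space UNIV)) \<and>
     (AE \<omega> in M. \<forall>j\<ge>j0.
        int (n (j + 1) \<omega>) =
          int (n j \<omega>) - (1 - of_bool (n j \<omega> = 0)) + int (num_arrivals \<xi> j \<omega>))"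

definition alpha ::
    "(int \<Rightarrow> 'a \<Rightarrow> real) \<Rightarrow> nat \<Rightarrow> (int \<Rightarrow> 'a \<Rightarrow> nat) \<Rightarrow> int \<Rightarrow> 'a \<Rightarrow> int" where
  "alpha \<xi> L n j \<omega> = int (n j \<omega>) - int (num_arrived \<xi> L j \<omega>)"

text \<open>
  \<open>p < q\<close> are consecutive zeros of the trajectory \<open>x\<close>; the busy period consists of the times
  in \<open>{p<..q}\<close> and ends at \<open>q\<close>.
\<close>

definition busy_period :: "int \<Rightarrow> (int \<Rightarrow> nat) \<Rightarrow> int \<Rightarrow> int \<Rightarrow> bool" where
  "busy_period j0 x p q \<longleftrightarrow>
     j0 \<le> p \<and> p < q \<and> x p = 0 \<and> x q = 0 \<and> (\<forall>j. p < j \<and> j < q \<longrightarrow> x j \<noteq> 0)"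

end

(*
Almost surely every delay lies in (-L, L), so the customers arrived by time j are those up to
j - L together with I_j; comparing times j and j + 1 gives the formula for m(j), and alpha can
only increase, by 1 at each zero of n. Once alpha > 0 we have n = alpha + |I| > 0, so alpha is
frozen. If I_j is empty then alpha(j) = n(j) >= 0, and if moreover alpha(j) = 0 then alpha jumps
to 1; hence alpha ends at max 1 (alpha j0) as soon as one I_j with j >= j0 is empty.

The initial queue may depend on all delays, so independence of |I_j| from the initial condition is
not available. Instead, |I_i| and |I_j| are independent for j >= i + 2L and identically distributed,
so the centred variables g(|I_j|) along sparse times are orthogonal and bounded; by Bessel's
inequality they tend weakly to 0 (Renyi's mixing argument), so that |I_j| is asymptotically
independent of every event. Applied to the event that no I_j is empty, the same fact shows that
this event is null when P(|I_0| = 0) > 0.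
*)
theory Submission
  imports Defs
begin

text \<open>Bridges limits over integer times and limits of sequences; dominated convergence is
  applied below to sequences.\<close>

lemma tendsto_at_top_int_sequentially:
  fixes c :: "int \<Rightarrow> 'b::topological_space"
  assumes "(\<lambda>m. c (j0 + int m)) \<longlonglongrightarrow> l"
  shows "(c \<longlongrightarrow> l) at_top"
proof -
  have "filterlim (\<lambda>j. nat (j - j0)) at_top at_top"
    unfolding filterlim_at_top eventually_at_top_linorder
  proof (intro allI exI impI)
    fix Z :: nat and j :: int
    assume "j0 + int Z \<le> j"
    then show "Z \<le> nat (j - j0)" by linarith
  qed
  then have "((\<lambda>j. c (j0 + int (nat (j - j0)))) \<longlongrightarrow> l) at_top"
    by (rule filterlim_compose[OF assms])
  moreover have "eventually (\<lambda>j. c (j0 + int (nat (j - j0))) = c j) at_top"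
    using eventually_ge_at_top[of j0] by eventually_elim simp
  ultimately show ?thesis
    by (rule Lim_transform_eventually)
qed

section \<open>Deterministic trajectories of the queue\<close>

text \<open>Here \<open>N\<close> plays the role of the number of arrived customers and
  \<open>int (x j) - int (N j)\<close> that of \<open>\<alpha> j\<close>.\<close>

locale queue_path =
  fixes j0 :: int and x N :: "int \<Rightarrow> nat"
  assumes step: "j0 \<le> j \<Longrightarrow>
    int (x (j + 1)) - int (N (j + 1)) = int (x j) - int (N j) + of_bool (x j = 0)"
begin

definition lag :: "int \<Rightarrow> int" where
  "lag j = int (x j) - int (N j)"

lemma lag_Suc: "j0 \<le> j \<Longrightarrow> lag (j + 1) = lag j + of_bool (x j = 0)"
  using step by (simp add: lag_def)

text \<open>Telescoping \<open>lag_Suc\<close>: every zero of \<open>x\<close> adds exactly one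
  unit. Monotonicity, constancy and the number of zeros are all read off from this count.\<close>

lemma lag_eq_add_card_zeros:
  assumes "j0 \<le> i" "i \<le> j"
  shows "lag j = lag i + int (card {k \<in> {i..<j}. x k = 0})"
  using assms(2)
proof (induction j rule: int_ge_induct)
  case (step k)
  have "{i..<k + 1} = insert k {i..<k}"
    using step.hyps by auto
  then have "{l \<in> {i..<k + 1}. x l = 0} = {l \<in> {i..<k}. x l = 0} \<union> (if x k = 0 then {k} else {})"
    by auto
  moreover have "card ({l \<in> {i..<k}. x l = 0} \<union> (if x k = 0 then {k} else {})) =
      card {l \<in> {i..<k}. x l = 0} + of_bool (x k = 0)"
    by (subst card_Un_disjoint) (auto intro: finite_subset[of _ "{i..<k}"])
  moreover have "lag (k + 1) = lag k + of_bool (x k = 0)"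
    using step.hyps assms(1) by (intro lag_Suc) simp
  ultimately show ?case
    using step.IH by simp
qed simp

lemma lag_mono: "j0 \<le> i \<Longrightarrow> i \<le> j \<Longrightarrow> lag i \<le> lag j"
  using lag_eq_add_card_zeros[of i j] by simp

lemma lag_pos_imp_nonzero: "lag j > 0 \<Longrightarrow> x j \<noteq> 0"
  by (auto simp: lag_def)

text \<open>By monotonicity \<open>lag\<close> stays positive after \<open>i\<close>; positivity
  excludes zeros of \<open>x\<close>, and without zeros nothing is added.\<close>

lemma lag_const:
  assumes "j0 \<le> i" "i \<le> j" "lag i > 0"
  shows "lag j = lag i"
proof -
  have "x k \<noteq> 0" if "i \<le> k" for k
    using lag_mono[of i k] that assms by (intro lag_pos_imp_nonzero) linarith
  then have "{k \<in> {i..<j}. x k = 0} = {}"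
    by auto
  then have "card {k \<in> {i..<j}. x k = 0} = 0"
    by (simp only: card.empty)
  then show ?thesis
    using lag_eq_add_card_zeros[of i j] assms by linarith
qed

text \<open>A rise occurs only at a zero of \<open>x\<close>, where \<open>lag\<close> equals minus
  \<open>N\<close> and hence is at most 0, so no rise leads beyond 1.\<close>

lemma lag_le:
  assumes "j0 \<le> j"
  shows "lag j \<le> max 1 (lag j0)"
  using assms
proof (induction j rule: int_ge_induct)
  case (step k)
  then show ?case
    using lag_Suc[of k] lag_pos_imp_nonzero[of k] by (cases "lag k > 0") auto
qed simp

lemma lag_limit:
  assumes "lag j0 > 0 \<or> (\<exists>j\<ge>j0. N j = 0)"
  obtains J where "j0 \<le> J" "\<And>j. J \<le> j \<Longrightarrow> lag j = max 1 (lag j0)"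
proof (cases "lag j0 > 0")
  case True
  have "lag j = max 1 (lag j0)" if "j0 \<le> j" for j
    using lag_const[OF order_refl that True] True by simp
  then show ?thesis
    using that[of j0] by blast
next
  case False
  with assms obtain k where k: "j0 \<le> k" "N k = 0" by auto
  \<comment> \<open>Since \<open>N k = 0\<close>, \<open>lag k\<close> equals \<open>x k\<close>: it
    is either positive already, or zero, and then the zero of \<open>x\<close> raises it to
    1.\<close>
  have "lag (k + 1) > 0"
    using lag_Suc[of k] k by (auto simp: lag_def)
  then have "lag (k + 1) = 1"
    using lag_le[of "k + 1"] k False by simp
  have "lag j = max 1 (lag j0)" if "k + 1 \<le> j" for j
    using lag_const[of "k + 1" j] that k False \<open>lag (k + 1) = 1\<close> by simp
  then show ?thesis
    using that[of "k + 1"] k by simp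
qed

text \<open>Once \<open>lag\<close> has reached 1 there are no further zeros, so the total rise from
  \<open>lag j0\<close> to 1 counts all of them.\<close>

lemma zeros_finite_card:
  assumes "lag j0 \<le> 0" "\<exists>j\<ge>j0. N j = 0"
  shows "finite {j. j \<ge> j0 \<and> x j = 0} \<and> int (card {j. j \<ge> j0 \<and> x j = 0}) = 1 - lag j0"
proof -
  obtain J where J: "j0 \<le> J" "\<And>j. J \<le> j \<Longrightarrow> lag j = max 1 (lag j0)"
    using lag_limit assms(2) by metis
  have "j < J" if "x j = 0" for j
    using J(2)[of j] lag_pos_imp_nonzero[of j] that assms(1) by (cases "j < J") auto
  then have eq: "{j. j \<ge> j0 \<and> x j = 0} = {k \<in> {j0..<J}. x k = 0}"
    by auto
  show ?thesis
    using lag_eq_add_card_zeros[of j0 J] J assms(1) unfolding eq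
    by (auto intro: finite_subset[of _ "{j0..<J}"])
qed

lemma lag_busy_period:
  assumes "busy_period j0 x p q"
  shows "\<forall>j\<in>{p<..q}. lag j = lag q" and "lag (q + 1) = lag q + 1"
proof -
  show "lag (q + 1) = lag q + 1"
    using assms lag_Suc[of q] by (simp add: busy_period_def)
  show "\<forall>j\<in>{p<..q}. lag j = lag q"
  proof
    fix j assume j: "j \<in> {p<..q}"
    \<comment> \<open>The zero at \<open>p\<close> lies before \<open>j\<close>, and the zero at
      \<open>q\<close> raises \<open>lag\<close> only at time \<open>q + 1\<close>; hence the
      half-open range up to \<open>q\<close> contains none.\<close>
    have "x k \<noteq> 0" if "j \<le> k" "k < q" for k
      using assms j that by (auto simp: busy_period_def)
    then have "{k \<in> {j..<q}. x k = 0} = {}"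
      by auto
    then have "card {k \<in> {j..<q}. x k = 0} = 0"
      by (simp only: card.empty)
    then show "lag j = lag q"
      using lag_eq_add_card_zeros[of j q] j assms by (simp add: busy_period_def)
  qed
qed

end

section \<open>Bessel's inequality and weak convergence to zero\<close>

context prob_space
begin

lemma expectation_of_bool:
  "expectation (\<lambda>\<omega>. of_bool (P \<omega>)) = \<P>(\<omega> in M. P \<omega>)"
proof -
  have "expectation (\<lambda>\<omega>. of_bool (P \<omega>)) = expectation (indicat_real {\<omega> \<in> space M. P \<omega>})"
    by (intro Bochner_Integration.integral_cong) (auto simp: indicator_def)
  also have "\<dots> = \<P>(\<omega> in M. P \<omega>)"
    unfolding Bochner_Integration.integral_indicator by (rule arg_cong[where f = prob]) auto
  finally show ?thesis .
qed

text \<open>Bessel's inequality for the indicator of \<open>A\<close>, whose square norm is at most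
  1. The \<open>X i\<close> are not normalised; their second moments are only bounded by the square
  of \<open>C\<close>, which accounts for the right-hand side.\<close>

lemma orthogonal_sequence_bessel:
  fixes X :: "nat \<Rightarrow> 'a \<Rightarrow> real"
  assumes A: "A \<in> events"
    and X: "\<And>i. X i \<in> borel_measurable M"
    and bnd: "\<And>i \<omega>. \<bar>X i \<omega>\<bar> \<le> C" and C: "C > 0"
    and orth: "\<And>i j. i < j \<Longrightarrow> expectation (\<lambda>\<omega>. X i \<omega> * X j \<omega>) = 0"
  shows "(\<Sum>i<m. (expectation (\<lambda>\<omega>. indicator A \<omega> * X i \<omega>))\<^sup>2) \<le> C\<^sup>2"
proof -
  note [measurable] = A X
  define c where "c i = expectation (\<lambda>\<omega>. indicator A \<omega> * X i \<omega>)" for i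
  define S where "S = (\<Sum>i<m. (c i)\<^sup>2)"
  \<comment> \<open>\<open>Y\<close> plays the role of the projection of the indicator onto the span
    of the \<open>X i\<close>; pairing it with the indicator gives \<open>S\<close>.\<close>
  define Y where "Y \<omega> = (\<Sum>i<m. c i * X i \<omega>)" for \<omega>
  have intXX: "integrable M (\<lambda>\<omega>. X i \<omega> * X j \<omega>)" for i j
  proof (rule integrable_const_bound[where B = "C * C"])
    show "AE \<omega> in M. norm (X i \<omega> * X j \<omega>) \<le> C * C"
      using bnd C by (auto simp: abs_mult intro!: mult_mono)
  qed measurable
  have intAX: "integrable M (\<lambda>\<omega>. indicator A \<omega> * X i \<omega>)" for i
    by (rule integrable_const_bound[where B = C])
      (use bnd C in \<open>auto simp: indicator_def\<close>)
  have orth': "expectation (\<lambda>\<omega>. X i \<omega> * X j \<omega>) = 0" if "i \<noteq> j" for i j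
    using orth[of i j] orth[of j i] that by (cases "i < j") (auto simp: mult.commute)
  have EYY: "expectation (\<lambda>\<omega>. Y \<omega> * Y \<omega>) = (\<Sum>i<m. (c i)\<^sup>2 * expectation (\<lambda>\<omega>. X i \<omega> * X i \<omega>))"
  proof -
    have "expectation (\<lambda>\<omega>. Y \<omega> * Y \<omega>) =
        expectation (\<lambda>\<omega>. \<Sum>i<m. \<Sum>j<m. c i * c j * (X i \<omega> * X j \<omega>))"
      unfolding Y_def sum_product by (intro Bochner_Integration.integral_cong refl sum.cong) simp
    also have "\<dots> = (\<Sum>i<m. \<Sum>j<m. c i * c j * expectation (\<lambda>\<omega>. X i \<omega> * X j \<omega>))"
      by (simp add: intXX)
    also have "\<dots> = (\<Sum>i<m. \<Sum>j<m. if i = j then (c i)\<^sup>2 * expectation (\<lambda>\<omega>. X i \<omega> * X i \<omega>) else 0)"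
      by (intro sum.cong refl) (simp add: orth' power2_eq_square)
    finally show ?thesis by simp
  qed
  have "expectation (\<lambda>\<omega>. X i \<omega> * X i \<omega>) \<le> C\<^sup>2" for i
  proof -
    have "X i \<omega> * X i \<omega> \<le> C\<^sup>2" for \<omega>
      using bnd[of i \<omega>] power_mono[of "\<bar>X i \<omega>\<bar>" C 2] by (simp add: power2_eq_square)
    then have "expectation (\<lambda>\<omega>. X i \<omega> * X i \<omega>) \<le> expectation (\<lambda>\<omega>. C\<^sup>2)"
      by (intro integral_mono intXX) auto
    then show ?thesis by (simp add: prob_space)
  qed
  then have EYY_le: "expectation (\<lambda>\<omega>. Y \<omega> * Y \<omega>) \<le> S * C\<^sup>2"
    unfolding EYY S_def sum_distrib_right by (intro sum_mono mult_left_mono) auto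
  have EAY: "expectation (\<lambda>\<omega>. indicator A \<omega> * Y \<omega>) = S"
  proof -
    have "expectation (\<lambda>\<omega>. indicator A \<omega> * Y \<omega>) =
        expectation (\<lambda>\<omega>. \<Sum>i<m. c i * (indicator A \<omega> * X i \<omega>))"
      unfolding Y_def sum_distrib_left
      by (intro Bochner_Integration.integral_cong refl sum.cong) simp
    also have "\<dots> = S"
      by (simp add: intAX S_def c_def power2_eq_square)
    finally show ?thesis .
  qed
  have intYY: "integrable M (\<lambda>\<omega>. Y \<omega> * Y \<omega>)"
    unfolding Y_def sum_product
  proof (intro Bochner_Integration.integrable_sum)
    show "integrable M (\<lambda>\<omega>. c i * X i \<omega> * (c j * X j \<omega>))" for i j
      using integrable_mult_right[OF intXX, of "c i * c j" i j] by (simp add: mult_ac)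
  qed
  have intAY: "integrable M (\<lambda>\<omega>. indicator A \<omega> * Y \<omega>)"
    unfolding Y_def sum_distrib_left
  proof (intro Bochner_Integration.integrable_sum)
    show "integrable M (\<lambda>\<omega>. indicator A \<omega> * (c i * X i \<omega>))" for i
      using integrable_mult_right[OF intAX, of "c i" i] by (simp add: mult_ac)
  qed
  \<comment> \<open>The weights \<open>C\<close> and \<open>1 / C\<close> cancel in the cross term,
    leaving \<open>2 * S\<close>, and bring the term quadratic in \<open>Y\<close> down to at most
    \<open>S\<close>.\<close>
  have "0 \<le> expectation (\<lambda>\<omega>. (C * indicator A \<omega> - Y \<omega> / C)\<^sup>2)"
    by simp
  also have "\<dots> = expectation (\<lambda>\<omega>. C\<^sup>2 * indicator A \<omega> - 2 * (indicator A \<omega> * Y \<omega>) + (Y \<omega> * Y \<omega>) / C\<^sup>2)"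
    using C by (intro Bochner_Integration.integral_cong refl)
      (auto simp: power2_eq_square field_simps indicator_def)
  also have "\<dots> = C\<^sup>2 * prob A - 2 * S + expectation (\<lambda>\<omega>. Y \<omega> * Y \<omega>) / C\<^sup>2"
    using A intYY intAY by (simp add: EAY less_top[symmetric])
  also have "\<dots> \<le> C\<^sup>2 - 2 * S + S"
  proof (intro add_mono diff_mono order_refl)
    show "C\<^sup>2 * prob A \<le> C\<^sup>2"
      using prob_le_1[of A] by (intro mult_left_le) auto
    show "expectation (\<lambda>\<omega>. Y \<omega> * Y \<omega>) / C\<^sup>2 \<le> S"
      using EYY_le C by (simp add: pos_divide_le_eq)
  qed
  finally show ?thesis
    by (simp add: S_def c_def)
qed

text \<open>If the coefficients did not tend to 0, infinitely many of them would stay at least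
  \<open>e\<close> in absolute value along times spaced by \<open>D\<close>. The corresponding
  variables are orthogonal, so Bessel's inequality would bound \<open>m * e^2\<close> uniformly in
  \<open>m\<close>.\<close>

lemma weak_limit_of_finite_range_orthogonal:
  fixes X :: "int \<Rightarrow> 'a \<Rightarrow> real"
  assumes A: "A \<in> events"
    and X: "\<And>i. X i \<in> borel_measurable M"
    and bnd: "\<And>i \<omega>. \<bar>X i \<omega>\<bar> \<le> C"
    and orth: "\<And>i j. i + int D \<le> j \<Longrightarrow> expectation (\<lambda>\<omega>. X i \<omega> * X j \<omega>) = 0"
  shows "((\<lambda>j. expectation (\<lambda>\<omega>. indicator A \<omega> * X j \<omega>)) \<longlongrightarrow> 0) at_top"
proof (rule ccontr)
  define c where "c i = expectation (\<lambda>\<omega>. indicator A \<omega> * X i \<omega>)" for i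
  assume "\<not> ?thesis"
  then obtain e where e: "e > 0" and "\<not> eventually (\<lambda>j. \<bar>c j\<bar> < e) at_top"
    by (auto simp: tendsto_iff c_def)
  then have ex: "\<exists>j\<ge>k. e \<le> \<bar>c j\<bar>" for k
    by (force simp: eventually_at_top_linorder not_less)
  obtain s :: "nat \<Rightarrow> int"
    where s: "\<And>m. e \<le> \<bar>c (s m)\<bar>" and s_step: "\<And>m. s m + int D \<le> s (Suc m)"
    using dependent_nat_choice[of "\<lambda>_ j. e \<le> \<bar>c j\<bar>" "\<lambda>_ i j. i + int D \<le> j"] ex by metis
  have s_gap: "s i + int D \<le> s j" if "i < j" for i j
  proof -
    have "Suc i \<le> j" using that by simp
    then have "s (Suc i) \<le> s j"
      by (rule lift_Suc_mono_le[rotated]) (use s_step in \<open>metis le_add_same_cancel1 of_nat_0_le_iff order_trans\<close>)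
    then show ?thesis using s_step[of i] by linarith
  qed
  \<comment> \<open>Bessel's inequality was proved for a strictly positive bound, which
    \<open>C\<close> need not be.\<close>
  define K where "K = max 1 C"
  have bessel: "(\<Sum>i<m. (c (s i))\<^sup>2) \<le> K\<^sup>2" for m
    unfolding c_def
  proof (rule orthogonal_sequence_bessel[OF A])
    show "\<bar>X (s i) \<omega>\<bar> \<le> K" for i \<omega>
      using bnd[of "s i" \<omega>] by (simp add: K_def)
  qed (use X s_gap orth in \<open>auto simp: K_def\<close>)
  have "real m * e\<^sup>2 \<le> K\<^sup>2" for m
  proof -
    have "(\<Sum>i<m. e\<^sup>2) \<le> (\<Sum>i<m. (c (s i))\<^sup>2)"
      using s e by (intro sum_mono) (metis abs_le_square_iff abs_of_pos)
    then show ?thesis using bessel[of m] by simp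
  qed
  moreover obtain m where "K\<^sup>2 / e\<^sup>2 < real m"
    using reals_Archimedean2 by blast
  then have "K\<^sup>2 < real m * e\<^sup>2"
    using e by (simp add: pos_divide_less_eq)
  ultimately show False
    by (meson not_le)
qed

end

section \<open>Measurability of counts, continuous densities, conditioning on an event\<close>

lemma measurable_card_Collect:
  assumes "finite K" and "\<And>k. k \<in> K \<Longrightarrow> Measurable.pred N (\<lambda>y. P k y)"
  shows "(\<lambda>y. card {k \<in> K. P k y}) \<in> measurable N (count_space UNIV)"
proof -
  have "card {k \<in> K. P k y} = (\<Sum>k\<in>K. of_bool (P k y))" for y
    using assms(1) by (simp add: of_bool_def sum.If_cases Int_def)
  moreover have "(\<lambda>y. \<Sum>k\<in>K. of_bool (P k y) :: nat) \<in> measurable N (count_space UNIV)"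
    using assms(2) by (intro measurable_sum_nat) auto
  ultimately show ?thesis by simp
qed

text \<open>By continuity \<open>f\<close> stays nonzero on an interval to the right of
  \<open>t\<close>, which lies inside \<open>{c..}\<close> and has positive Lebesgue
  measure.\<close>

lemma measure_density_pos:
  fixes f :: "real \<Rightarrow> real"
  assumes cont: "continuous_on UNIV f" and nonneg: "\<And>t. 0 \<le> f t"
    and fin: "finite_measure (density lborel f)" and t: "t > c" "f t \<noteq> 0"
  shows "measure (density lborel f) {c..} > 0"
proof -
  interpret finite_measure "density lborel f" by (rule fin)
  have [measurable]: "f \<in> borel_measurable borel"
    using cont by (rule borel_measurable_continuous_onI)
  have "isCont f t"
    using cont by (simp add: continuous_on_eq_continuous_at)
  then obtain d where d: "d > 0" "\<And>y. \<bar>t - y\<bar> < d \<Longrightarrow> f y \<noteq> 0"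
    using continuous_at_avoid[of t f 0] t by (auto simp: dist_real_def)
  have "{c..} \<notin> null_sets (density lborel f)"
  proof
    assume "{c..} \<in> null_sets (density lborel f)"
    then have "AE x in lborel. x \<in> {c..} \<longrightarrow> ennreal (f x) = 0"
      by (subst (asm) null_sets_density_iff) auto
    then have "AE x in lborel. x \<notin> {t<..<t + d}"
    proof eventually_elim
      case (elim x)
      then show ?case
        using d(2)[of x] nonneg[of x] t by (auto simp: ennreal_eq_0_iff)
    qed
    then have "emeasure lborel {t<..<t + d} = 0"
      by (subst (asm) AE_iff_null_sets[symmetric]) auto
    then show False using d by simp
  qed
  then have "measure (density lborel f) {c..} \<noteq> 0"
    by (auto simp: null_sets_def emeasure_eq_measure)
  then show ?thesis
    by (simp add: zero_less_measure_iff)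
qed

text \<open>Turns means under the conditional law given \<open>A\<close> into the ratios to which
  the mixing argument applies.\<close>

lemma (in prob_space) expectation_uniform_measure:
  fixes g :: "'a \<Rightarrow> real"
  assumes [measurable]: "A \<in> events" "g \<in> borel_measurable M" and pos: "prob A > 0"
  shows "integral\<^sup>L (uniform_measure M A) g = expectation (\<lambda>\<omega>. indicator A \<omega> * g \<omega>) / prob A"
proof -
  have "uniform_measure M A = density M (\<lambda>\<omega>. ennreal (indicator A \<omega> / prob A))"
    unfolding uniform_measure_def
    using pos by (intro density_cong) (auto simp: indicator_def emeasure_eq_measure divide_ennreal[symmetric])
  then show ?thesis
    by (simp add: integral_density)
qed

section \<open>The number of arrived customers: stationarity, independence at distance,
  mixing\<close>

text \<open>From the density only the common law \<open>\<mu>\<close> and the bound are kept. The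
  bound is strict, so that customer \<open>j - L\<close> has arrived strictly before time
  \<open>j\<close>; it also forces \<open>L\<close> to be positive.\<close>

locale bounded_delays = prob_space M for M :: "'a measure" +
  fixes \<xi> :: "int \<Rightarrow> 'a \<Rightarrow> real" and L :: nat and \<mu> :: "real measure"
  assumes indep: "indep_vars (\<lambda>_. borel) \<xi> UNIV"
    and ident: "distr M borel (\<xi> i) = \<mu>"
    and bounded: "AE \<omega> in M. \<forall>i. \<bar>\<xi> i \<omega>\<bar> < real L"
begin

definition offsets :: "int set" where
  "offsets = {1 - int L..int L - 1}"

text \<open>Indices are taken relative to the observation time, so that one and the same functional,
  applied to shifted delays, gives the size of every \<open>I_j\<close>.\<close>

definition count_early :: "(int \<Rightarrow> real) \<Rightarrow> nat" where
  "count_early y = card {k \<in> offsets. real_of_int k + y k < 0}"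

lemma finite_offsets [simp]: "finite offsets"
  by (simp add: offsets_def)

lemma delay_measurable [measurable]: "\<xi> i \<in> borel_measurable M"
  using indep by (simp add: indep_vars_def)

lemma num_arrived_eq_count_early: "num_arrived \<xi> L j \<omega> = count_early (\<lambda>k. \<xi> (j + k) \<omega>)"
proof -
  have "arrived \<xi> L j \<omega> = (\<lambda>k. j + k) ` {k \<in> offsets. real_of_int k + \<xi> (j + k) \<omega> < 0}"
  proof (intro set_eqI iffI)
    fix i assume "i \<in> arrived \<xi> L j \<omega>"
    then show "i \<in> (\<lambda>k. j + k) ` {k \<in> offsets. real_of_int k + \<xi> (j + k) \<omega> < 0}"
      by (intro image_eqI[of _ _ "i - j"]) (auto simp: arrived_def arrival_time_def offsets_def)
  qed (auto simp: arrived_def arrival_time_def offsets_def)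
  then show ?thesis
    by (simp add: count_early_def card_image)
qed

text \<open>One more than the sharp bound for positive \<open>L\<close>, which avoids truncated
  subtraction.\<close>

lemma num_arrived_le: "num_arrived \<xi> L j \<omega> \<le> 2 * L"
proof -
  have "num_arrived \<xi> L j \<omega> \<le> card offsets"
    unfolding num_arrived_eq_count_early count_early_def by (intro card_mono) auto
  then show ?thesis by (simp add: offsets_def)
qed

lemma count_early_restrict: "count_early (restrict y offsets) = count_early y"
  unfolding count_early_def by (intro arg_cong[where f = card]) auto

lemma count_early_measurable:
  assumes "(\<lambda>k. j + k) ` offsets \<subseteq> K"
  shows "(\<lambda>y. count_early (\<lambda>k. y (j + k))) \<in> measurable (PiM K (\<lambda>_. borel)) (count_space UNIV)"
  unfolding count_early_def
proof (rule measurable_card_Collect)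
  fix k assume "k \<in> offsets"
  then have [measurable]: "(\<lambda>y. y (j + k)) \<in> measurable (PiM K (\<lambda>_. borel)) borel"
    using assms by (intro measurable_component_singleton) auto
  show "Measurable.pred (PiM K (\<lambda>_. borel)) (\<lambda>y. real_of_int k + y (j + k) < 0)"
    by measurable
qed simp

lemma num_arrived_measurable [measurable]:
  "num_arrived \<xi> L j \<in> measurable M (count_space UNIV)"
  unfolding num_arrived_eq_count_early[abs_def] count_early_def
  by (intro measurable_card_Collect) auto

text \<open>This is stationarity: the right-hand side is free of \<open>j\<close>. The delays in the
  window around \<open>j\<close> have a product of copies of \<open>\<mu>\<close> as joint law, and
  \<open>count_early\<close> depends on this window only.\<close>

lemma distr_num_arrived:
  "distr M (count_space UNIV) (num_arrived \<xi> L j) =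
    distr (PiM offsets (\<lambda>_. \<mu>)) (count_space UNIV) count_early"
\<comment> \<open>The characterisation of independence by product laws is applied with a nonempty
  index set; for an empty window the count is constantly 0.\<close>
proof (cases "offsets = {}")
  case True
  interpret P: prob_space "PiM offsets (\<lambda>_. \<mu>)"
    using prob_space_distr[OF delay_measurable] unfolding ident by (intro prob_space_PiM)
  show ?thesis
    unfolding num_arrived_eq_count_early[abs_def] count_early_def[abs_def] True
    using distr_const[of "0 :: nat" "count_space UNIV"] P.distr_const[of "0 :: nat" "count_space UNIV"]
    by (simp add: True)
next
  case False
  define X where "X \<omega> = (\<lambda>k\<in>offsets. \<xi> (j + k) \<omega>)" for \<omega>
  \<comment> \<open>Shifting the index: the delays are grouped into singleton blocks
    \<open>{j + k}\<close> labelled by \<open>k\<close>, and each block is then evaluated at its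
    only point.\<close>
  have "indep_vars (\<lambda>k. PiM {j + k} (\<lambda>_. borel)) (\<lambda>k \<omega>. restrict (\<lambda>i. \<xi> i \<omega>) {j + k}) offsets"
    by (rule indep_vars_restrict[OF indep]) (auto simp: disjoint_family_on_def)
  then have "indep_vars (\<lambda>_. borel) (\<lambda>k \<omega>. restrict (\<lambda>i. \<xi> i \<omega>) {j + k} (j + k)) offsets"
    by (rule indep_vars_compose2) auto
  then have "indep_vars (\<lambda>_. borel) (\<lambda>k. \<xi> (j + k)) offsets"
    by simp
  then have D: "distr M (PiM offsets (\<lambda>_. borel)) X = PiM offsets (\<lambda>_. \<mu>)"
    using indep_vars_iff_distr_eq_PiM'[OF False, where M' = "\<lambda>_. borel" and X = "\<lambda>k. \<xi> (j + k)"]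
    by (simp add: X_def[abs_def] ident)
  have X: "X \<in> measurable M (PiM offsets (\<lambda>_. borel))"
    unfolding X_def by measurable
  have "distr (PiM offsets (\<lambda>_. \<mu>)) (count_space UNIV) count_early =
      distr M (count_space UNIV) (count_early \<circ> X)"
    unfolding D[symmetric]
    using count_early_measurable[of 0 offsets] X by (intro distr_distr) auto
  also have "count_early \<circ> X = num_arrived \<xi> L j"
    by (auto simp: X_def num_arrived_eq_count_early count_early_restrict)
  finally show ?thesis ..
qed

lemma distr_num_arrived_eq:
  "distr M (count_space UNIV) (num_arrived \<xi> L j) =
    distr M (count_space UNIV) (num_arrived \<xi> L 0)"
  by (simp only: distr_num_arrived)

lemma expectation_num_arrived:
  fixes g :: "nat \<Rightarrow> real"
  shows "expectation (\<lambda>\<omega>. g (num_arrived \<xi> L j \<omega>)) = expectation (\<lambda>\<omega>. g (num_arrived \<xi> L 0 \<omega>))"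
proof -
  have "expectation (\<lambda>\<omega>. g (num_arrived \<xi> L i \<omega>)) =
      integral\<^sup>L (distr M (count_space UNIV) (num_arrived \<xi> L i)) g" for i
    by (rule integral_distr[symmetric]) auto
  then show ?thesis
    by (simp add: distr_num_arrived_eq[of j])
qed

lemma prob_num_arrived:
  "\<P>(\<omega> in M. P (num_arrived \<xi> L j \<omega>)) = \<P>(\<omega> in M. P (num_arrived \<xi> L 0 \<omega>))"
proof -
  have "\<P>(\<omega> in M. P (num_arrived \<xi> L i \<omega>)) =
      measure (distr M (count_space UNIV) (num_arrived \<xi> L i)) {x. P x}" for i
    by (subst measure_distr) (auto intro!: arg_cong[where f = "measure M"])
  then show ?thesis
    by (simp add: distr_num_arrived_eq[of j])
qed

text \<open>The two counts depend on delays in index windows of radius \<open>L - 1\<close>, which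
  are disjoint at this distance.\<close>

lemma num_arrived_indep:
  assumes "i + int (2 * L) \<le> j"
  shows "indep_var (count_space UNIV) (num_arrived \<xi> L i) (count_space UNIV) (num_arrived \<xi> L j)"
proof -
  define W where "W i = (\<lambda>k. i + k) ` offsets" for i :: int
  have "W i \<inter> W j = {}"
    using assms by (auto simp: W_def offsets_def)
  then have "indep_var (PiM (W i) (\<lambda>_. borel)) (\<lambda>\<omega>. restrict (\<lambda>i. \<xi> i \<omega>) (W i))
      (PiM (W j) (\<lambda>_. borel)) (\<lambda>\<omega>. restrict (\<lambda>i. \<xi> i \<omega>) (W j))"
    by (intro indep_var_restrict[OF indep]) auto
  then have "indep_var
      (count_space UNIV) ((\<lambda>y. count_early (\<lambda>k. y (i + k))) \<circ> (\<lambda>\<omega>. restrict (\<lambda>i. \<xi> i \<omega>) (W i)))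
      (count_space UNIV) ((\<lambda>y. count_early (\<lambda>k. y (j + k))) \<circ> (\<lambda>\<omega>. restrict (\<lambda>i. \<xi> i \<omega>) (W j)))"
    by (rule indep_var_compose) (auto intro!: count_early_measurable simp: W_def)
  moreover have "(\<lambda>y. count_early (\<lambda>k. y (l + k))) \<circ> (\<lambda>\<omega>. restrict (\<lambda>i. \<xi> i \<omega>) (W l)) =
      num_arrived \<xi> L l" for l
    unfolding num_arrived_eq_count_early[abs_def] count_early_def
    by (auto simp: W_def fun_eq_iff intro!: arg_cong[where f = card])
  ultimately show ?thesis by simp
qed

text \<open>The event \<open>A\<close> is arbitrary: it may depend on all delays and on an independent source.\<close>

lemma num_arrived_mixing:
  fixes g :: "nat \<Rightarrow> real"
  assumes A: "A \<in> events"
  shows "((\<lambda>j. expectation (\<lambda>\<omega>. indicator A \<omega> * g (num_arrived \<xi> L j \<omega>))) \<longlongrightarrow>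
    prob A * expectation (\<lambda>\<omega>. g (num_arrived \<xi> L 0 \<omega>))) at_top"
proof -
  note [measurable] = A
  define e where "e = expectation (\<lambda>\<omega>. g (num_arrived \<xi> L 0 \<omega>))"
  define X where "X j \<omega> = g (num_arrived \<xi> L j \<omega>) - e" for j \<omega>
  \<comment> \<open>An arbitrary \<open>g\<close> is bounded along the process, because the count
    takes only values up to \<open>2 * L\<close>.\<close>
  define C where "C = (\<Sum>k\<le>2 * L. \<bar>g k\<bar>) + \<bar>e\<bar>"
  have g_le: "\<bar>g (num_arrived \<xi> L j \<omega>)\<bar> \<le> (\<Sum>k\<le>2 * L. \<bar>g k\<bar>)" for j \<omega>
    using num_arrived_le[of j \<omega>] by (intro member_le_sum) auto
  have bnd: "\<bar>X j \<omega>\<bar> \<le> C" for j \<omega>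
    using g_le[of j \<omega>] by (simp add: X_def C_def)
  have int_g: "integrable M (\<lambda>\<omega>. g (num_arrived \<xi> L j \<omega>))" for j
    using g_le by (intro integrable_const_bound[where B = "\<Sum>k\<le>2 * L. \<bar>g k\<bar>"]) auto
  have X_meas [measurable]: "X j \<in> borel_measurable M" for j
    unfolding X_def[abs_def] by measurable
  have int_X: "integrable M (X j)" for j
    using bnd by (intro integrable_const_bound[where B = C]) auto
  have EX: "expectation (X j) = 0" for j
    using int_g[of j] expectation_num_arrived[of g j] by (simp add: X_def[abs_def] e_def prob_space)
  have "((\<lambda>j. expectation (\<lambda>\<omega>. indicator A \<omega> * X j \<omega>)) \<longlongrightarrow> 0) at_top"
  proof (rule weak_limit_of_finite_range_orthogonal[OF A X_meas bnd])
    fix i j assume "i + int (2 * L) \<le> j"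
    then have "indep_var borel ((\<lambda>k. g k - e) \<circ> num_arrived \<xi> L i)
        borel ((\<lambda>k. g k - e) \<circ> num_arrived \<xi> L j)"
      by (intro indep_var_compose[OF num_arrived_indep]) auto
    then have "indep_var borel (X i) borel (X j)"
      by (simp add: X_def[abs_def] comp_def)
    then show "expectation (\<lambda>\<omega>. X i \<omega> * X j \<omega>) = 0"
      using int_X by (simp add: indep_var_lebesgue_integral EX)
  qed
  \<comment> \<open>The mean removed in \<open>X\<close> is put back, which produces the product
    form of the limit.\<close>
  then have "((\<lambda>j. expectation (\<lambda>\<omega>. indicator A \<omega> * X j \<omega>) + prob A * e) \<longlongrightarrow> 0 + prob A * e) at_top"
    by (intro tendsto_intros)
  moreover have "expectation (\<lambda>\<omega>. indicator A \<omega> * X j \<omega>) + prob A * e =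
      expectation (\<lambda>\<omega>. indicator A \<omega> * g (num_arrived \<xi> L j \<omega>))" for j
  proof -
    have "integrable M (\<lambda>\<omega>. indicator A \<omega> * g (num_arrived \<xi> L j \<omega>))"
      using integrable_mult_indicator[OF A int_g[of j]] by simp
    moreover have "integrable M (\<lambda>\<omega>. indicator A \<omega> * e)"
      using A by (intro integrable_mult_left) (simp add: less_top[symmetric])
    ultimately show ?thesis
      using A by (simp add: X_def right_diff_distrib)
  qed
  ultimately show ?thesis
    by (simp add: e_def)
qed

text \<open>On the exceptional event \<open>A\<close> the indicator of an empty \<open>I_j\<close>
  vanishes for every \<open>j\<close> from \<open>j0\<close> on, so its mean over \<open>A\<close>
  is 0. By mixing this mean tends to \<open>prob A\<close> times a positive number, hence
  \<open>A\<close> is null.\<close>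

lemma AE_ex_num_arrived_eq_0:
  assumes "\<P>(\<omega> in M. num_arrived \<xi> L 0 \<omega> = 0) > 0"
  shows "AE \<omega> in M. \<exists>j\<ge>j0. num_arrived \<xi> L j \<omega> = 0"
proof -
  define A where "A = {\<omega> \<in> space M. \<forall>j\<in>{j0..}. num_arrived \<xi> L j \<omega> \<noteq> 0}"
  have A: "A \<in> events"
    unfolding A_def by measurable
  have p: "expectation (\<lambda>\<omega>. of_bool (num_arrived \<xi> L 0 \<omega> = 0)) =
      \<P>(\<omega> in M. num_arrived \<xi> L 0 \<omega> = 0)"
    by (rule expectation_of_bool)
  have "expectation (\<lambda>\<omega>. indicator A \<omega> * of_bool (num_arrived \<xi> L j \<omega> = 0)) = (0 :: real)" if "j \<ge> j0" for j
  proof -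
    have "expectation (\<lambda>\<omega>. indicator A \<omega> * of_bool (num_arrived \<xi> L j \<omega> = 0)) =
        expectation (\<lambda>\<omega>. 0 :: real)"
      using that by (intro Bochner_Integration.integral_cong) (auto simp: A_def indicator_def)
    then show ?thesis by simp
  qed
  then have "((\<lambda>j. expectation (\<lambda>\<omega>. indicator A \<omega> * of_bool (num_arrived \<xi> L j \<omega> = 0))) \<longlongrightarrow> (0 :: real))
      at_top"
    by (intro tendsto_eventually eventually_at_top_linorderI)
  then have "prob A * expectation (\<lambda>\<omega>. of_bool (num_arrived \<xi> L 0 \<omega> = 0)) = 0"
    using num_arrived_mixing[OF A, of "\<lambda>k. of_bool (k = 0)"] tendsto_unique
      trivial_limit_at_top_linorder by blast
  then have "prob A = 0"
    using assms by (simp add: p)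
  then have "AE \<omega> in M. \<omega> \<notin> A"
    using A by (intro AE_not_in) (simp add: null_sets_def emeasure_eq_measure)
  then show ?thesis
    using AE_space by eventually_elim (auto simp: A_def)
qed

text \<open>Two counts of the customers relevant to the step from \<open>j\<close> to
  \<open>j + 1\<close>. The extra 1 is customer \<open>j + 1 - L\<close>, who leaves the observation
  window and has certainly arrived by time \<open>j + 1\<close>.\<close>

lemma AE_num_arrivals:
  "AE \<omega> in M. \<forall>j. finite (arrivals \<xi> j \<omega>) \<and>
    int (num_arrivals \<xi> j \<omega>) =
      int (num_arrived \<xi> L (j + 1) \<omega>) - int (num_arrived \<xi> L j \<omega>) + 1"
  using bounded
proof eventually_elim
  case (elim \<omega>)
  show ?case
  proof
    fix j
    have lt: "real_of_int i + \<xi> i \<omega> < real_of_int i + real L"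
      and gt: "real_of_int i - real L < real_of_int i + \<xi> i \<omega>" for i
      using elim[rule_format, of i] by auto
    have early: "real_of_int i + \<xi> i \<omega> < real_of_int k" if "i \<le> k - int L" for i k
    proof -
      have "real_of_int i + real L \<le> real_of_int k" using that by linarith
      then show ?thesis using lt[of i] by linarith
    qed
    have late: "real_of_int k < real_of_int i + \<xi> i \<omega>" if "i \<ge> k + int L" for i k
    proof -
      have "real_of_int k \<le> real_of_int i - real L" using that by linarith
      then show ?thesis using gt[of i] by linarith
    qed
    have "real L > 0"
      using elim[rule_format, of 0] by linarith
    \<comment> \<open>Needed for customer \<open>j + 1 - L\<close> to belong to the window at time
      \<open>j\<close>.\<close>
    then have L: "int L \<ge> 1" by simp
    have fin: "finite (arrived \<xi> L k \<omega>)" for k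
      by (rule finite_subset[of _ "{k - int L + 1..k + int L - 1}"]) (auto simp: arrived_def)
    have sub: "arrivals \<xi> j \<omega> \<subseteq> {j - int L..j + int L}"
    proof
      fix i assume i: "i \<in> arrivals \<xi> j \<omega>"
      then have "\<not> i \<le> j - int L" "\<not> i \<ge> j + 1 + int L"
        using early[of i j] late[of "j + 1" i]
        by (auto simp: arrivals_def arrival_time_def)
      then show "i \<in> {j - int L..j + int L}" by auto
    qed
    then have fin': "finite (arrivals \<xi> j \<omega>)"
      by (rule finite_subset) simp
    \<comment> \<open>Indices below \<open>j + 1 - L\<close> arrived before \<open>j\<close>, and
      those above \<open>j + L\<close> arrive after \<open>j + 1\<close>, so neither side contains
      them. Customer \<open>j + L\<close> is new in the window and cannot have arrived before
      \<open>j\<close>.\<close>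
    have eq: "insert (j + 1 - int L) (arrived \<xi> L (j + 1) \<omega>) = arrived \<xi> L j \<omega> \<union> arrivals \<xi> j \<omega>"
    proof (intro set_eqI)
      fix i
      show "i \<in> insert (j + 1 - int L) (arrived \<xi> L (j + 1) \<omega>) \<longleftrightarrow>
          i \<in> arrived \<xi> L j \<omega> \<union> arrivals \<xi> j \<omega>"
        using early[of i j] early[of i "j + 1"] late[of j i] late[of "j + 1" i] L
        by (cases "i < j + 1 - int L"; cases "i > j + int L"; cases "i = j + 1 - int L";
            cases "i = j + int L")
          (auto simp: arrived_def arrivals_def arrival_time_def)
    qed
    have "card (insert (j + 1 - int L) (arrived \<xi> L (j + 1) \<omega>)) = Suc (num_arrived \<xi> L (j + 1) \<omega>)"
      by (rule card_insert_disjoint[OF fin]) (simp add: arrived_def)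
    moreover have "card (arrived \<xi> L j \<omega> \<union> arrivals \<xi> j \<omega>) =
        num_arrived \<xi> L j \<omega> + num_arrivals \<xi> j \<omega>"
      by (rule card_Un_disjoint[OF fin fin']) (auto simp: arrived_def arrivals_def)
    ultimately show "finite (arrivals \<xi> j \<omega>) \<and> int (num_arrivals \<xi> j \<omega>) =
      int (num_arrived \<xi> L (j + 1) \<omega>) - int (num_arrived \<xi> L j \<omega>) + 1"
      using fin' unfolding eq by simp
  qed
qed

text \<open>If every delay in the window is at least \<open>L - 1\<close>, even customer
  \<open>1 - L\<close> has not arrived before time 0, so \<open>I_0\<close> is empty. By
  independence this has a product of finitely many positive numbers as probability.\<close>

lemma prob_num_arrived_eq_0_pos:
  assumes "measure \<mu> {real L - 1..} > 0"
  shows "\<P>(\<omega> in M. num_arrived \<xi> L 0 \<omega> = 0) > 0"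
proof (cases "offsets = {}")
  case True
  then show ?thesis
    by (simp add: num_arrived_eq_count_early count_early_def prob_space)
next
  case False
  have *: "prob (\<xi> k -` {real L - 1..} \<inter> space M) = measure \<mu> {real L - 1..}" for k
    unfolding ident[of k, symmetric] by (rule measure_distr[symmetric]) auto
  have "0 < (\<Prod>k\<in>offsets. prob (\<xi> k -` {real L - 1..} \<inter> space M))"
    using assms by (intro prod_pos) (simp add: *)
  also have "\<dots> = prob (\<Inter>k\<in>offsets. \<xi> k -` {real L - 1..} \<inter> space M)"
    using False by (intro indep_varsD[OF indep, symmetric]) auto
  also have "\<dots> \<le> \<P>(\<omega> in M. num_arrived \<xi> L 0 \<omega> = 0)"
  proof (rule finite_measure_mono)
    show "(\<Inter>k\<in>offsets. \<xi> k -` {real L - 1..} \<inter> space M) \<subseteq>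
        {\<omega> \<in> space M. num_arrived \<xi> L 0 \<omega> = 0}"
    proof
      fix \<omega> assume \<omega>: "\<omega> \<in> (\<Inter>k\<in>offsets. \<xi> k -` {real L - 1..} \<inter> space M)"
      have "real_of_int k + \<xi> k \<omega> \<ge> 0" if "k \<in> offsets" for k
      proof -
        have "real_of_int k \<ge> 1 - real L"
          using that unfolding offsets_def by (simp add: of_int_le_iff[symmetric, where 'a=real] del: of_int_le_iff)
        moreover have "\<xi> k \<omega> \<ge> real L - 1"
          using INT_D[OF \<omega> that] by simp
        ultimately show ?thesis by linarith
      qed
      then have "{k \<in> offsets. real_of_int k + \<xi> k \<omega> < 0} = {}"
        by (auto simp: not_less)
      then show "\<omega> \<in> {\<omega> \<in> space M. num_arrived \<xi> L 0 \<omega> = 0}"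
        using \<omega> False by (auto simp: num_arrived_eq_count_early count_early_def)
    qed
  qed measurable
  finally show ?thesis .
qed

end

section \<open>The queue driven by the delays: pathwise facts and limit laws\<close>

locale delayed_queue = bounded_delays +
  fixes j0 :: int and n :: "int \<Rightarrow> 'a \<Rightarrow> nat"
  assumes queue: "queue_process M \<xi> j0 n"
begin

lemma queue_measurable: "j0 \<le> j \<Longrightarrow> n j \<in> measurable M (count_space UNIV)"
  using queue by (simp add: queue_process_def)

lemma alpha_measurable: "j0 \<le> j \<Longrightarrow> alpha \<xi> L n j \<in> measurable M (count_space UNIV)"
  unfolding alpha_def[abs_def]
  using queue_measurable[of j] by measurable

lemma alpha_event: "j0 \<le> j \<Longrightarrow> {\<omega> \<in> space M. alpha \<xi> L n j \<omega> = a} \<in> events"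
  using alpha_measurable[of j] by measurable

text \<open>The initial length may depend on all delays, so every later time \<open>J\<close> is an
  admissible starting time. This transfers results about the initial \<open>alpha\<close> to a value
  reached later.\<close>

lemma delayed_queue_later: "j0 \<le> J \<Longrightarrow> delayed_queue M \<xi> L \<mu> J n"
proof unfold_locales
  assume "j0 \<le> J"
  then show "queue_process M \<xi> J n"
    using queue unfolding queue_process_def
    by (smt (verit, best) eventually_mono)
qed

text \<open>The customer served cancels the 1 in the arrivals formula, leaving the Kronecker delta.
  One null set serves all times, so the deterministic lemmas hold along almost every path.\<close>

lemma AE_queue_path: "AE \<omega> in M. queue_path j0 (\<lambda>j. n j \<omega>) (\<lambda>j. num_arrived \<xi> L j \<omega>)"
proof -
  have "AE \<omega> in M. \<forall>j\<ge>j0. int (n (j + 1) \<omega>) =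
      int (n j \<omega>) - (1 - of_bool (n j \<omega> = 0)) + int (num_arrivals \<xi> j \<omega>)"
    using queue by (simp add: queue_process_def)
  then show ?thesis
    using AE_num_arrivals by eventually_elim (auto simp: queue_path_def)
qed

lemma alpha_eq_lag:
  "queue_path j0 (\<lambda>j. n j \<omega>) (\<lambda>j. num_arrived \<xi> L j \<omega>) \<Longrightarrow>
    alpha \<xi> L n j \<omega> = queue_path.lag (\<lambda>j. n j \<omega>) (\<lambda>j. num_arrived \<xi> L j \<omega>) j"
  by (simp add: alpha_def queue_path.lag_def)

lemma AE_queue_Suc:
  "AE \<omega> in M. \<forall>j\<ge>j0.
    int (n (j + 1) \<omega>) =
      int (n j \<omega>) + int (num_arrived \<xi> L (j + 1) \<omega>) - int (num_arrived \<xi> L j \<omega>)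
        + of_bool (n j \<omega> = 0)"
  using AE_queue_path
proof eventually_elim
  case (elim \<omega>)
  then show ?case
    by (auto dest: queue_path.step)
qed

lemma AE_alpha_Suc:
  "AE \<omega> in M. \<forall>j\<ge>j0. alpha \<xi> L n (j + 1) \<omega> = alpha \<xi> L n j \<omega> + of_bool (n j \<omega> = 0)"
  using AE_queue_path
proof eventually_elim
  case (elim \<omega>)
  then show ?case
    unfolding alpha_eq_lag[OF elim] using queue_path.lag_Suc[OF elim] by blast
qed

lemma AE_alpha_busy_period:
  "AE \<omega> in M. \<forall>p q. busy_period j0 (\<lambda>j. n j \<omega>) p q \<longrightarrow>
    (\<forall>j\<in>{p<..q}. alpha \<xi> L n j \<omega> = alpha \<xi> L n q \<omega>) \<and>
    alpha \<xi> L n (q + 1) \<omega> = alpha \<xi> L n q \<omega> + 1"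
  using AE_queue_path
proof eventually_elim
  case (elim \<omega>)
  then show ?case
    unfolding alpha_eq_lag[OF elim] using queue_path.lag_busy_period[OF elim] by blast
qed

lemma AE_alpha_pos:
  "AE \<omega> in M. alpha \<xi> L n j0 \<omega> > 0 \<longrightarrow>
    (\<forall>j\<ge>j0. n j \<omega> \<noteq> 0 \<and> alpha \<xi> L n j \<omega> = alpha \<xi> L n j0 \<omega>)"
  using AE_queue_path
proof eventually_elim
  case (elim \<omega>)
  show ?case
    unfolding alpha_eq_lag[OF elim]
    using queue_path.lag_const[OF elim order_refl] queue_path.lag_pos_imp_nonzero[OF elim] by metis
qed

text \<open>A bound uniform in \<open>j\<close>; it supplies the domination for limits of the mean
  queue length.\<close>

lemma AE_queue_le:
  "AE \<omega> in M. \<forall>j\<ge>j0. int (n j \<omega>) \<le> max 1 (alpha \<xi> L n j0 \<omega>) + 2 * int L"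
  using AE_queue_path
proof eventually_elim
  case (elim \<omega>)
  show ?case
  proof (intro allI impI)
    fix j assume "j0 \<le> j"
    then have "alpha \<xi> L n j \<omega> \<le> max 1 (alpha \<xi> L n j0 \<omega>)"
      unfolding alpha_eq_lag[OF elim] by (rule queue_path.lag_le[OF elim])
    then show "int (n j \<omega>) \<le> max 1 (alpha \<xi> L n j0 \<omega>) + 2 * int L"
      using num_arrived_le[of j \<omega>] by (simp add: alpha_def)
  qed
qed

lemma AE_alpha_limit:
  assumes "AE \<omega> in M. \<exists>j\<ge>j0. num_arrived \<xi> L j \<omega> = 0"
  shows "AE \<omega> in M. \<exists>J\<ge>j0. \<forall>j\<ge>J. alpha \<xi> L n j \<omega> = max 1 (alpha \<xi> L n j0 \<omega>)"
  using AE_queue_path assms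
proof eventually_elim
  case (elim \<omega>)
  show ?case
    unfolding alpha_eq_lag[OF elim(1)] using queue_path.lag_limit[OF elim(1)] elim(2) by metis
qed

lemma AE_zeros:
  assumes "AE \<omega> in M. \<exists>j\<ge>j0. num_arrived \<xi> L j \<omega> = 0"
  shows "AE \<omega> in M. alpha \<xi> L n j0 \<omega> \<le> 0 \<longrightarrow>
    finite {j. j \<ge> j0 \<and> n j \<omega> = 0} \<and>
    int (card {j. j \<ge> j0 \<and> n j \<omega> = 0}) = 1 - alpha \<xi> L n j0 \<omega> \<and>
    (\<exists>J\<ge>j0. \<forall>j\<ge>J. alpha \<xi> L n j \<omega> = 1)"
  using AE_queue_path assms AE_alpha_limit[OF assms]
proof eventually_elim
  case (elim \<omega>)
  show ?case
    using queue_path.zeros_finite_card[OF elim(1) _ elim(2)] elim(3)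
    unfolding alpha_eq_lag[OF elim(1)] by (auto simp: max_def)
qed

lemma AE_queue_of_alpha_pos:
  assumes "AE \<omega> in M. alpha \<xi> L n j0 \<omega> = a" "a > 0" "j0 \<le> j"
  shows "AE \<omega> in M. int (n j \<omega>) = a + int (num_arrived \<xi> L j \<omega>)"
  using AE_alpha_pos assms(1)
proof eventually_elim
  case (elim \<omega>)
  then have "alpha \<xi> L n j \<omega> = a"
    using assms by simp
  then show ?case by (simp add: alpha_def)
qed

lemma expectation_queue_of_alpha_pos:
  assumes "AE \<omega> in M. alpha \<xi> L n j0 \<omega> = a" "a > 0" "j0 \<le> j"
  shows "integrable M (\<lambda>\<omega>. real (n j \<omega>)) \<and>
    expectation (\<lambda>\<omega>. real (n j \<omega>)) =
      real_of_int a + expectation (\<lambda>\<omega>. real (num_arrived \<xi> L 0 \<omega>))"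
proof -
  note [measurable] = queue_measurable[OF assms(3)]
  have int_N: "integrable M (\<lambda>\<omega>. real (num_arrived \<xi> L j \<omega>))"
    using num_arrived_le[of j]
    by (intro integrable_const_bound[where B = "real (2 * L)"]) (auto simp del: of_nat_mult)
  have ae: "AE \<omega> in M. real_of_int a + real (num_arrived \<xi> L j \<omega>) = real (n j \<omega>)"
    using AE_queue_of_alpha_pos[OF assms]
  proof eventually_elim
    case (elim \<omega>)
    then have "real_of_int (int (n j \<omega>)) = real_of_int (a + int (num_arrived \<xi> L j \<omega>))"
      by (simp only:)
    then show ?case by simp
  qed
  have "integrable M (\<lambda>\<omega>. real_of_int a + real (num_arrived \<xi> L j \<omega>))"
    using int_N by simp
  then have "integrable M (\<lambda>\<omega>. real (n j \<omega>))"
    by (rule integrable_cong_AE_imp) (use ae in auto)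
  moreover have "expectation (\<lambda>\<omega>. real (n j \<omega>)) =
      expectation (\<lambda>\<omega>. real_of_int a + real (num_arrived \<xi> L j \<omega>))"
    using ae by (intro integral_cong_AE) (auto elim!: eventually_mono)
  moreover have "\<dots> = real_of_int a + expectation (\<lambda>\<omega>. real (num_arrived \<xi> L 0 \<omega>))"
    using int_N expectation_num_arrived[of real j] by (simp add: prob_space)
  ultimately show ?thesis by simp
qed

lemma prob_queue_of_alpha_pos:
  assumes "AE \<omega> in M. alpha \<xi> L n j0 \<omega> = a" "a > 0" "j0 \<le> j"
  shows "\<P>(\<omega> in M. n j \<omega> = k) = \<P>(\<omega> in M. int (num_arrived \<xi> L 0 \<omega>) = int k - a)"
proof -
  note [measurable] = queue_measurable[OF assms(3)]
  have "\<P>(\<omega> in M. n j \<omega> = k) = \<P>(\<omega> in M. int (num_arrived \<xi> L j \<omega>) = int k - a)"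
    using AE_queue_of_alpha_pos[OF assms]
    by (intro prob_eq_AE) (auto elim!: eventually_mono)
  also have "\<dots> = \<P>(\<omega> in M. int (num_arrived \<xi> L 0 \<omega>) = int k - a)"
    by (rule prob_num_arrived)
  finally show ?thesis .
qed

lemma AE_queue_ge:
  assumes "a > 0"
  shows "AE \<omega> in M. alpha \<xi> L n j0 \<omega> = a \<longrightarrow> (\<forall>j\<ge>j0. int (n j \<omega>) \<ge> a)"
  using AE_alpha_pos
proof eventually_elim
  case (elim \<omega>)
  show ?case
  proof (intro impI allI)
    fix j assume "alpha \<xi> L n j0 \<omega> = a" "j0 \<le> j"
    then have "alpha \<xi> L n j \<omega> = a"
      using elim assms by simp
    then show "a \<le> int (n j \<omega>)"
      by (simp add: alpha_def)
  qed
qed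

text \<open>Almost surely on \<open>A\<close> the queue is eventually \<open>b\<close> plus the size
  of \<open>I_j\<close>. Dominated convergence justifies replacing the queue by this sum, and mixing
  makes the sum asymptotically independent of \<open>A\<close>, on which both may depend.\<close>

lemma expectation_limit_on_event:
  fixes h :: "int \<Rightarrow> real"
  assumes A: "A \<in> events"
    and ev: "AE \<omega> in M. \<omega> \<in> A \<longrightarrow> (\<exists>J. \<forall>j\<ge>J. alpha \<xi> L n j \<omega> = b)"
    and bnd: "\<And>j. j0 \<le> j \<Longrightarrow> AE \<omega> in M. \<omega> \<in> A \<longrightarrow> \<bar>h (int (n j \<omega>))\<bar> \<le> C"
  shows "((\<lambda>j. expectation (\<lambda>\<omega>. indicator A \<omega> * h (int (n j \<omega>)))) \<longlongrightarrow>
    prob A * expectation (\<lambda>\<omega>. h (b + int (num_arrived \<xi> L 0 \<omega>)))) at_top"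
proof (rule tendsto_at_top_int_sequentially[of _ j0])
  define g where "g k = h (b + int k)" for k
  define s where "s m \<omega> = indicator A \<omega> * h (int (n (j0 + int m) \<omega>))" for m \<omega>
  \<comment> \<open>\<open>t\<close> is the stationary substitute for \<open>s\<close>: on
    \<open>A\<close> the two agree from a random time on.\<close>
  define t where "t m \<omega> = indicator A \<omega> * g (num_arrived \<xi> L (j0 + int m) \<omega>)" for m \<omega>
  define K where "K = (\<Sum>k\<le>2 * L. \<bar>g k\<bar>)"
  have [measurable]: "n (j0 + int m) \<in> measurable M (count_space UNIV)" for m
    by (rule queue_measurable) simp
  note [measurable] = A
  have meas [measurable]: "s m \<in> borel_measurable M" "t m \<in> borel_measurable M" for m
    unfolding s_def[abs_def] t_def[abs_def] by measurable
  \<comment> \<open>The absolute value covers paths outside \<open>A\<close>, where \<open>s\<close>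
    is 0 while the sign of \<open>C\<close> is unknown.\<close>
  have s_le: "AE \<omega> in M. \<bar>s m \<omega>\<bar> \<le> \<bar>C\<bar>" for m
    using bnd[of "j0 + int m"] by (auto elim!: eventually_mono simp: s_def indicator_def)
  have t_le: "\<bar>t m \<omega>\<bar> \<le> K" for m \<omega>
  proof -
    have "\<bar>g (num_arrived \<xi> L (j0 + int m) \<omega>)\<bar> \<le> K"
      unfolding K_def using num_arrived_le by (intro member_le_sum) auto
    then show ?thesis
      by (auto simp: t_def indicator_def)
  qed
  have int_s: "integrable M (s m)" for m
    using s_le by (intro integrable_const_bound[where B = "\<bar>C\<bar>"]) auto
  have int_t: "integrable M (t m)" for m
    using t_le by (intro integrable_const_bound[where B = K]) auto
  have "(\<lambda>m. expectation (\<lambda>\<omega>. s m \<omega> - t m \<omega>)) \<longlonglongrightarrow> expectation (\<lambda>\<omega>. 0)"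
  proof (rule integral_dominated_convergence[where w = "\<lambda>_. \<bar>C\<bar> + K"])
    show "AE \<omega> in M. norm (s m \<omega> - t m \<omega>) \<le> \<bar>C\<bar> + K" for m
      using s_le[of m]
    proof eventually_elim
      case (elim \<omega>)
      then show ?case using t_le[of m \<omega>] by simp
    qed
    show "AE \<omega> in M. (\<lambda>m. s m \<omega> - t m \<omega>) \<longlonglongrightarrow> 0"
      using ev
    proof eventually_elim
      case (elim \<omega>)
      show ?case
      proof (cases "\<omega> \<in> A")
        case True
        with elim obtain J where J: "\<And>j. j \<ge> J \<Longrightarrow> alpha \<xi> L n j \<omega> = b" by blast
        have "s m \<omega> - t m \<omega> = 0" if "m \<ge> nat (J - j0)" for m
        proof -
          have "int (n (j0 + int m) \<omega>) = b + int (num_arrived \<xi> L (j0 + int m) \<omega>)"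
            using J[of "j0 + int m"] that unfolding alpha_def by linarith
          then show ?thesis
            by (simp only: s_def t_def g_def)
        qed
        then show ?thesis
          by (intro tendsto_eventually) (auto simp: eventually_sequentially)
      qed (simp add: s_def t_def)
    qed
  qed auto
  moreover have "(\<lambda>m. expectation (t m)) \<longlonglongrightarrow> prob A * expectation (\<lambda>\<omega>. g (num_arrived \<xi> L 0 \<omega>))"
    unfolding t_def[abs_def]
  proof (rule filterlim_compose[OF num_arrived_mixing[OF A]])
    show "filterlim (\<lambda>m. j0 + int m) at_top sequentially"
      unfolding filterlim_at_top eventually_sequentially
    proof (intro allI exI impI)
      fix Z :: int and m :: nat
      assume "nat (Z - j0) \<le> m"
      then show "Z \<le> j0 + int m" by linarith
    qed
  qed
  ultimately have "(\<lambda>m. expectation (\<lambda>\<omega>. s m \<omega> - t m \<omega>) + expectation (t m)) \<longlonglongrightarrow>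
      expectation (\<lambda>\<omega>. 0) + prob A * expectation (\<lambda>\<omega>. g (num_arrived \<xi> L 0 \<omega>))"
    by (rule tendsto_add)
  then show "(\<lambda>m. expectation (\<lambda>\<omega>. indicator A \<omega> * h (int (n (j0 + int m) \<omega>)))) \<longlonglongrightarrow>
      prob A * expectation (\<lambda>\<omega>. h (b + int (num_arrived \<xi> L 0 \<omega>)))"
    using int_s int_t by (simp add: g_def s_def[abs_def])
qed

lemma prob_limit_on_event:
  assumes A: "{\<omega> \<in> space M. Q \<omega>} \<in> events"
    and ev: "AE \<omega> in M. Q \<omega> \<longrightarrow> (\<exists>J. \<forall>j\<ge>J. alpha \<xi> L n j \<omega> = b)"
  shows "((\<lambda>j. \<P>(\<omega> in M. n j \<omega> = k \<and> Q \<omega>)) \<longlongrightarrow>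
    \<P>(\<omega> in M. Q \<omega>) * \<P>(\<omega> in M. int (num_arrived \<xi> L 0 \<omega>) = int k - b)) at_top"
proof -
  have "((\<lambda>j. expectation (\<lambda>\<omega>. indicator {\<omega> \<in> space M. Q \<omega>} \<omega> * of_bool (int (n j \<omega>) = int k))) \<longlongrightarrow>
      \<P>(\<omega> in M. Q \<omega>) * expectation (\<lambda>\<omega>. of_bool (b + int (num_arrived \<xi> L 0 \<omega>) = int k))) at_top"
    by (rule expectation_limit_on_event[OF A, where C = 1])
      (use ev in \<open>auto elim!: eventually_mono\<close>)
  moreover have "expectation (\<lambda>\<omega>. indicator {\<omega> \<in> space M. Q \<omega>} \<omega> * of_bool (int (n j \<omega>) = int k)) =
      \<P>(\<omega> in M. n j \<omega> = k \<and> Q \<omega>)" for j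
    unfolding expectation_of_bool[symmetric]
    by (intro Bochner_Integration.integral_cong) (auto simp: indicator_def)
  moreover have "(b + int (num_arrived \<xi> L 0 \<omega>) = int k) =
      (int (num_arrived \<xi> L 0 \<omega>) = int k - b)" for \<omega>
    by auto
  ultimately show ?thesis
    by (simp only: expectation_of_bool)
qed

lemma cond_prob_limit:
  assumes A: "{\<omega> \<in> space M. Q \<omega>} \<in> events" and pos: "\<P>(\<omega> in M. Q \<omega>) > 0"
    and ev: "AE \<omega> in M. Q \<omega> \<longrightarrow> (\<exists>J. \<forall>j\<ge>J. alpha \<xi> L n j \<omega> = b)"
  shows "((\<lambda>j. \<P>(\<omega> in M. n j \<omega> = k \<bar> Q \<omega>)) \<longlongrightarrow>
    \<P>(\<omega> in M. int (num_arrived \<xi> L 0 \<omega>) = int k - b)) at_top"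
  using tendsto_divide[OF prob_limit_on_event[OF A ev, of k] tendsto_const[of "\<P>(\<omega> in M. Q \<omega>)"]] pos
  by (simp add: cond_prob_def)

text \<open>The identity is an unbounded choice of \<open>h\<close>; the bound on the initial
  \<open>alpha\<close> over \<open>A\<close> makes the queue length uniformly bounded there.\<close>

lemma expectation_queue_limit_on_event:
  assumes A: "A \<in> events"
    and ev: "AE \<omega> in M. \<omega> \<in> A \<longrightarrow> (\<exists>J. \<forall>j\<ge>J. alpha \<xi> L n j \<omega> = b)"
    and le: "AE \<omega> in M. \<omega> \<in> A \<longrightarrow> alpha \<xi> L n j0 \<omega> \<le> a"
  shows "((\<lambda>j. expectation (\<lambda>\<omega>. indicator A \<omega> * real (n j \<omega>))) \<longlongrightarrow>
    prob A * (real_of_int b + expectation (\<lambda>\<omega>. real (num_arrived \<xi> L 0 \<omega>)))) at_top"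
proof -
  have "((\<lambda>j. expectation (\<lambda>\<omega>. indicator A \<omega> * real_of_int (int (n j \<omega>)))) \<longlongrightarrow>
      prob A * expectation (\<lambda>\<omega>. real_of_int (b + int (num_arrived \<xi> L 0 \<omega>)))) at_top"
  proof (rule expectation_limit_on_event[OF A ev, where C = "real_of_int (max 1 a + 2 * int L)"])
    fix j assume "j0 \<le> j"
    show "AE \<omega> in M. \<omega> \<in> A \<longrightarrow> \<bar>real_of_int (int (n j \<omega>))\<bar> \<le> real_of_int (max 1 a + 2 * int L)"
      using AE_queue_le le
    proof eventually_elim
      case (elim \<omega>)
      show ?case
      proof
        assume "\<omega> \<in> A"
        then have "int (n j \<omega>) \<le> max 1 a + 2 * int L"
          using elim \<open>j0 \<le> j\<close> by (smt (verit))
        then show "\<bar>real_of_int (int (n j \<omega>))\<bar> \<le> real_of_int (max 1 a + 2 * int L)"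
          by simp
      qed
    qed
  qed
  moreover have "integrable M (\<lambda>\<omega>. real (num_arrived \<xi> L 0 \<omega>))"
    using num_arrived_le[of 0]
    by (intro integrable_const_bound[where B = "real (2 * L)"]) (auto simp del: of_nat_mult)
  ultimately show ?thesis
    by (simp add: prob_space)
qed

lemma integrable_queue:
  assumes "AE \<omega> in M. alpha \<xi> L n j0 \<omega> \<le> a" "j0 \<le> j"
  shows "integrable M (\<lambda>\<omega>. real (n j \<omega>))"
proof (rule integrable_const_bound)
  note [measurable] = queue_measurable[OF assms(2)]
  show "(\<lambda>\<omega>. real (n j \<omega>)) \<in> borel_measurable M"
    by measurable
  show "AE \<omega> in M. norm (real (n j \<omega>)) \<le> real_of_int (max 1 a + 2 * int L)"
    using AE_queue_le assms(1)
  proof eventually_elim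
    case (elim \<omega>)
    then have "int (n j \<omega>) \<le> max 1 a + 2 * int L"
      using \<open>j0 \<le> j\<close> by (smt (verit))
    then have "real_of_int (int (n j \<omega>)) \<le> real_of_int (max 1 a + 2 * int L)"
      by (simp only: of_int_le_iff)
    then show ?case by simp
  qed
qed

lemma expectation_cond_limit:
  assumes A: "A \<in> events" and pos: "prob A > 0"
    and ev: "AE \<omega> in M. \<omega> \<in> A \<longrightarrow> (\<exists>J. \<forall>j\<ge>J. alpha \<xi> L n j \<omega> = b)"
    and le: "AE \<omega> in M. \<omega> \<in> A \<longrightarrow> alpha \<xi> L n j0 \<omega> \<le> a"
  shows "((\<lambda>j. prob_space.expectation (uniform_measure M A) (\<lambda>\<omega>. real (n j \<omega>))) \<longlongrightarrow>
    real_of_int b + expectation (\<lambda>\<omega>. real (num_arrived \<xi> L 0 \<omega>))) at_top"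
proof -
  have "((\<lambda>j. expectation (\<lambda>\<omega>. indicator A \<omega> * real (n j \<omega>)) / prob A) \<longlongrightarrow>
      real_of_int b + expectation (\<lambda>\<omega>. real (num_arrived \<xi> L 0 \<omega>))) at_top"
    using tendsto_divide[OF expectation_queue_limit_on_event[OF A ev le] tendsto_const[of "prob A"]] pos
    by simp
  \<comment> \<open>Only eventually, since \<open>n j\<close> is known to be measurable from
    \<open>j0\<close> on.\<close>
  moreover have "eventually (\<lambda>j. expectation (\<lambda>\<omega>. indicator A \<omega> * real (n j \<omega>)) / prob A =
      integral\<^sup>L (uniform_measure M A) (\<lambda>\<omega>. real (n j \<omega>))) at_top"
    using eventually_ge_at_top[of j0]
  proof eventually_elim
    case (elim j)
    note [measurable] = queue_measurable[OF elim]
    show ?case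
      by (rule expectation_uniform_measure[symmetric, OF A _ pos]) measurable
  qed
  ultimately show ?thesis
    by (rule Lim_transform_eventually)
qed

text \<open>The value \<open>max 1 a\<close> covers both regimes: a positive \<open>a\<close> is
  frozen at once, any other climbs to 1 provided that some \<open>I_j\<close> is empty.\<close>

lemma AE_alpha_eventually:
  assumes "a > 0 \<or> (AE \<omega> in M. \<exists>j\<ge>j0. num_arrived \<xi> L j \<omega> = 0)"
  shows "AE \<omega> in M. alpha \<xi> L n j0 \<omega> = a \<longrightarrow> (\<exists>J. \<forall>j\<ge>J. alpha \<xi> L n j \<omega> = max 1 a)"
  using assms
proof
  assume "a > 0"
  show ?thesis
    using AE_alpha_pos
  proof eventually_elim
    case (elim \<omega>)
    with \<open>a > 0\<close> show ?case by (auto intro!: exI[of _ j0])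
  qed
next
  assume "AE \<omega> in M. \<exists>j\<ge>j0. num_arrived \<xi> L j \<omega> = 0"
  from AE_alpha_limit[OF this] show ?thesis
    by eventually_elim auto
qed

end

section \<open>Delays with a continuous density, and the stationary laws\<close>

theorem mainTheorem3:
  fixes M :: "'a measure"
    and \<xi> :: "int \<Rightarrow> 'a \<Rightarrow> real"
    and f :: "real \<Rightarrow> real"
    and \<sigma> :: real
    and L :: nat
    and j0 :: int
    and n :: "int \<Rightarrow> 'a \<Rightarrow> nat"
  assumes prob: "prob_space M"
    and indep: "prob_space.indep_vars M (\<lambda>_. borel) \<xi> UNIV"
    and f_nonneg: "\<And>t. 0 \<le> f t"
    and f_cont: "continuous_on UNIV f"
    and density: "\<And>i. distributed M lborel (\<xi> i) (\<lambda>t. ennreal (f t))"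
    and mean: "\<And>i. prob_space.expectation M (\<xi> i) = 0"
    and var: "\<And>i. prob_space.variance M (\<xi> i) = \<sigma>\<^sup>2"
    and f_supp: "\<And>t. \<bar>t\<bar> > real L \<Longrightarrow> f t = 0"
    and queue: "queue_process M \<xi> j0 n"
  shows
    "
    \<comment> \<open>arrivals, queue length, and alpha\<close>
     ((AE \<omega> in M. \<forall>j. finite (arrivals \<xi> j \<omega>) \<and>
        int (num_arrivals \<xi> j \<omega>) =
          int (num_arrived \<xi> L (j + 1) \<omega>) - int (num_arrived \<xi> L j \<omega>) + 1) \<and>
     (AE \<omega> in M. \<forall>j\<ge>j0.
        int (n (j + 1) \<omega>) =
          int (n j \<omega>) + int (num_arrived \<xi> L (j + 1) \<omega>) - int (num_arrived \<xi> L j \<omega>)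
            + of_bool (n j \<omega> = 0)) \<and>
     (AE \<omega> in M. \<forall>j\<ge>j0.
        alpha \<xi> L n (j + 1) \<omega> = alpha \<xi> L n j \<omega> + of_bool (n j \<omega> = 0)) \<and>
     (AE \<omega> in M. \<forall>p q. busy_period j0 (\<lambda>j. n j \<omega>) p q \<longrightarrow>
        (\<forall>j\<in>{p<..q}. alpha \<xi> L n j \<omega> = alpha \<xi> L n q \<omega>) \<and>
        alpha \<xi> L n (q + 1) \<omega> = alpha \<xi> L n q \<omega> + 1)) \<and>
    \<comment> \<open>the common distribution of the number of arrived customers; time 0 represents it below\<close>
     (\<forall>j. num_arrived \<xi> L j \<in> measurable M (count_space UNIV) \<and>
        distr M (count_space UNIV) (num_arrived \<xi> L j) =
          distr M (count_space UNIV) (num_arrived \<xi> L 0)) \<and>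
    \<comment> \<open>(a)\<close>
     ((AE \<omega> in M. alpha \<xi> L n j0 \<omega> > 0 \<longrightarrow>
           (\<forall>j\<ge>j0. n j \<omega> \<noteq> 0 \<and> alpha \<xi> L n j \<omega> = alpha \<xi> L n j0 \<omega>)) \<and>
         (\<forall>a>0. (AE \<omega> in M. alpha \<xi> L n j0 \<omega> = a) \<longrightarrow>
           (\<forall>j\<ge>j0. integrable M (\<lambda>\<omega>. real (n j \<omega>)) \<and>
              prob_space.expectation M (\<lambda>\<omega>. real (n j \<omega>)) =
                real_of_int a + prob_space.expectation M (\<lambda>\<omega>. real (num_arrived \<xi> L 0 \<omega>))))) \<and>
    \<comment> \<open>(b); the premise says that the bound \<open>L\<close> on the positive delays is sharp among integers\<close>
     ((\<exists>t. t > real L - 1 \<and> f t \<noteq> 0) \<longrightarrow>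
         ((AE \<omega> in M. alpha \<xi> L n j0 \<omega> \<le> 0 \<longrightarrow>
           finite {j. j \<ge> j0 \<and> n j \<omega> = 0} \<and>
           int (card {j. j \<ge> j0 \<and> n j \<omega> = 0}) = 1 - alpha \<xi> L n j0 \<omega> \<and>
           (\<exists>J\<ge>j0. \<forall>j\<ge>J. alpha \<xi> L n j \<omega> = 1)) \<and>
         ((AE \<omega> in M. alpha \<xi> L n j0 \<omega> \<le> 0) \<longrightarrow>
           (\<forall>j\<ge>j0. integrable M (\<lambda>\<omega>. real (n j \<omega>))) \<and>
           ((\<lambda>j. prob_space.expectation M (\<lambda>\<omega>. real (n j \<omega>))) \<longlongrightarrow>
              1 + prob_space.expectation M (\<lambda>\<omega>. real (num_arrived \<xi> L 0 \<omega>))) at_top \<and>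
           (\<forall>k. ((\<lambda>j. \<P>(\<omega> in M. n j \<omega> = k)) \<longlongrightarrow>
              \<P>(\<omega> in M. int (num_arrived \<xi> L 0 \<omega>) = int k - 1)) at_top)))) \<and>
    \<comment> \<open>(c); \<open>J\<close> is a time at which the value \<open>a > 0\<close> of alpha has been reached\<close>
     (\<forall>J\<ge>j0. \<forall>a>0.
         ((AE \<omega> in M. alpha \<xi> L n J \<omega> = a) \<longrightarrow>
            (\<forall>j\<ge>J. \<forall>k. \<P>(\<omega> in M. n j \<omega> = k) =
               \<P>(\<omega> in M. int (num_arrived \<xi> L 0 \<omega>) = int k - a))) \<and>
         (\<P>(\<omega> in M. alpha \<xi> L n J \<omega> = a) > 0 \<longrightarrow>
            (\<forall>k. ((\<lambda>j. \<P>(\<omega> in M. n j \<omega> = k \<bar> alpha \<xi> L n J \<omega> = a)) \<longlongrightarrow>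
               \<P>(\<omega> in M. int (num_arrived \<xi> L 0 \<omega>) = int k - a)) at_top)) \<and>
         (AE \<omega> in M. alpha \<xi> L n J \<omega> = a \<longrightarrow> (\<forall>j\<ge>J. int (n j \<omega>) \<ge> a))) \<and>
    \<comment> \<open>arbitrary, possibly random, initial condition: stationary law and mean given the
      initial value of alpha\<close>
     (\<forall>a. \<P>(\<omega> in M. alpha \<xi> L n j0 \<omega> = a) > 0 \<and>
           (a > 0 \<or> (\<exists>t. t > real L - 1 \<and> f t \<noteq> 0)) \<longrightarrow>
         (\<forall>k. ((\<lambda>j. \<P>(\<omega> in M. n j \<omega> = k \<bar> alpha \<xi> L n j0 \<omega> = a)) \<longlongrightarrow>
            \<P>(\<omega> in M. int (num_arrived \<xi> L 0 \<omega>) = int k - max 1 a)) at_top) \<and>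
         ((\<lambda>j. prob_space.expectation
                 (uniform_measure M {\<omega> \<in> space M. alpha \<xi> L n j0 \<omega> = a})
                 (\<lambda>\<omega>. real (n j \<omega>))) \<longlongrightarrow>
            real_of_int (max 1 a) +
              prob_space.expectation M (\<lambda>\<omega>. real (num_arrived \<xi> L 0 \<omega>))) at_top)"
proof -
  interpret prob_space M by (rule prob)
  define \<mu> where "\<mu> = density lborel f"
  have ident: "distr M borel (\<xi> i) = \<mu>" for i
    using distributed_distr_eq_density[OF density[of i]] by (simp add: \<mu>_def cong: distr_cong)
  have \<xi>_meas [measurable]: "\<xi> i \<in> borel_measurable M" for i
    using indep by (simp add: indep_vars_def)
  have [measurable]: "f \<in> borel_measurable borel"
    using f_cont by (rule borel_measurable_continuous_onI)
  \<comment> \<open>The support condition leaves the two endpoints open; as Lebesgue null sets they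
    can be discarded, and the bound becomes strict.\<close>
  have "AE x in lborel. 0 < ennreal (f x) \<longrightarrow> \<bar>x\<bar> < real L"
    using AE_lborel_singleton[of "real L"] AE_lborel_singleton[of "- real L"]
  proof eventually_elim
    case (elim x)
    then show ?case using f_supp[of x] by (cases "\<bar>x\<bar> > real L") auto
  qed
  then have "AE x in \<mu>. \<bar>x\<bar> < real L"
    unfolding \<mu>_def by (subst AE_density) auto
  then have "AE \<omega> in M. \<bar>\<xi> i \<omega>\<bar> < real L" for i
    unfolding ident[of i, symmetric] by (subst (asm) AE_distr_iff) auto
  then have bounded: "AE \<omega> in M. \<forall>i. \<bar>\<xi> i \<omega>\<bar> < real L"
    by (simp add: AE_all_countable)
  interpret delayed_queue M \<xi> L \<mu> j0 n
    using indep ident bounded queue by unfold_locales auto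
  \<comment> \<open>Sharpness of \<open>L\<close> gives the delays positive mass on
    \<open>{L - 1..}\<close>, which makes an empty \<open>I_0\<close> possible.\<close>
  have empty: "AE \<omega> in M. \<exists>j\<ge>j0. num_arrived \<xi> L j \<omega> = 0" if sharp: "\<exists>t. t > real L - 1 \<and> f t \<noteq> 0"
  proof -
    obtain t where "t > real L - 1" "f t \<noteq> 0"
      using sharp by blast
    moreover have "finite_measure \<mu>"
      unfolding ident[of 0, symmetric] by (rule prob_space.axioms(1)[OF prob_space_distr]) auto
    ultimately have "measure \<mu> {real L - 1..} > 0"
      unfolding \<mu>_def using f_cont f_nonneg by (intro measure_density_pos)
    then show ?thesis
      by (intro AE_ex_num_arrived_eq_0 prob_num_arrived_eq_0_pos)
  qed
  have b: "(\<forall>j\<ge>j0. integrable M (\<lambda>\<omega>. real (n j \<omega>))) \<and>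
      ((\<lambda>j. expectation (\<lambda>\<omega>. real (n j \<omega>))) \<longlongrightarrow>
        1 + expectation (\<lambda>\<omega>. real (num_arrived \<xi> L 0 \<omega>))) at_top \<and>
      (\<forall>k. ((\<lambda>j. \<P>(\<omega> in M. n j \<omega> = k)) \<longlongrightarrow>
        \<P>(\<omega> in M. int (num_arrived \<xi> L 0 \<omega>) = int k - 1)) at_top)"
    if sharp: "\<exists>t. t > real L - 1 \<and> f t \<noteq> 0" and le: "AE \<omega> in M. alpha \<xi> L n j0 \<omega> \<le> 0"
  proof (intro conjI allI impI)
    have ev: "AE \<omega> in M. \<exists>J. \<forall>j\<ge>J. alpha \<xi> L n j \<omega> = 1"
      using AE_alpha_limit[OF empty[OF sharp]] le by eventually_elim auto
    show "integrable M (\<lambda>\<omega>. real (n j \<omega>))" if "j0 \<le> j" for j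
      by (rule integrable_queue[OF le that])
    \<comment> \<open>The unconditional limit is the case of the whole space. The starting value of
      \<open>alpha\<close> may still be random, since all values up to 0 lead to 1.\<close>
    have "((\<lambda>j. expectation (\<lambda>\<omega>. indicator (space M) \<omega> * real (n j \<omega>))) \<longlongrightarrow>
        prob (space M) * (real_of_int 1 + expectation (\<lambda>\<omega>. real (num_arrived \<xi> L 0 \<omega>)))) at_top"
      by (rule expectation_queue_limit_on_event[where a = 0]) (use ev le in auto)
    moreover have "expectation (\<lambda>\<omega>. indicator (space M) \<omega> * real (n j \<omega>)) =
        expectation (\<lambda>\<omega>. real (n j \<omega>))" for j
      by (intro Bochner_Integration.integral_cong) auto
    ultimately show "((\<lambda>j. expectation (\<lambda>\<omega>. real (n j \<omega>))) \<longlongrightarrow>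
        1 + expectation (\<lambda>\<omega>. real (num_arrived \<xi> L 0 \<omega>))) at_top"
      by (simp add: prob_space)
    show "((\<lambda>j. \<P>(\<omega> in M. n j \<omega> = k)) \<longlongrightarrow>
        \<P>(\<omega> in M. int (num_arrived \<xi> L 0 \<omega>) = int k - 1)) at_top" for k
      using prob_limit_on_event[of "\<lambda>_. True" 1 k] ev by (simp add: prob_space)
  qed
  have c: "(\<forall>k. ((\<lambda>j. \<P>(\<omega> in M. n j \<omega> = k \<bar> alpha \<xi> L n J \<omega> = a)) \<longlongrightarrow>
       \<P>(\<omega> in M. int (num_arrived \<xi> L 0 \<omega>) = int k - a)) at_top)"
    if "j0 \<le> J" "a > 0" "\<P>(\<omega> in M. alpha \<xi> L n J \<omega> = a) > 0" for J a
  proof -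
    \<comment> \<open>Restarting at \<open>J\<close> makes the value reached there an initial value,
      which stays frozen because it is positive.\<close>
    interpret later: delayed_queue M \<xi> L \<mu> J n
      by (rule delayed_queue_later[OF that(1)])
    show ?thesis
      using later.cond_prob_limit[OF alpha_event[OF that(1)] that(3)] later.AE_alpha_eventually[of a] that(2)
      by simp
  qed
  have law: "(\<forall>k. ((\<lambda>j. \<P>(\<omega> in M. n j \<omega> = k \<bar> alpha \<xi> L n j0 \<omega> = a)) \<longlongrightarrow>
        \<P>(\<omega> in M. int (num_arrived \<xi> L 0 \<omega>) = int k - max 1 a)) at_top) \<and>
      ((\<lambda>j. prob_space.expectation (uniform_measure M {\<omega> \<in> space M. alpha \<xi> L n j0 \<omega> = a})
          (\<lambda>\<omega>. real (n j \<omega>))) \<longlongrightarrow>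
        real_of_int (max 1 a) + expectation (\<lambda>\<omega>. real (num_arrived \<xi> L 0 \<omega>))) at_top"
    if pos: "\<P>(\<omega> in M. alpha \<xi> L n j0 \<omega> = a) > 0"
      and "a > 0 \<or> (\<exists>t. t > real L - 1 \<and> f t \<noteq> 0)" for a
  proof (intro conjI allI)
    have ev: "AE \<omega> in M. alpha \<xi> L n j0 \<omega> = a \<longrightarrow> (\<exists>J. \<forall>j\<ge>J. alpha \<xi> L n j \<omega> = max 1 a)"
      using that(2) empty by (intro AE_alpha_eventually) blast
    show "((\<lambda>j. \<P>(\<omega> in M. n j \<omega> = k \<bar> alpha \<xi> L n j0 \<omega> = a)) \<longlongrightarrow>
        \<P>(\<omega> in M. int (num_arrived \<xi> L 0 \<omega>) = int k - max 1 a)) at_top" for k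
      by (rule cond_prob_limit[OF alpha_event[OF order_refl] pos ev])
    show "((\<lambda>j. prob_space.expectation (uniform_measure M {\<omega> \<in> space M. alpha \<xi> L n j0 \<omega> = a})
          (\<lambda>\<omega>. real (n j \<omega>))) \<longlongrightarrow>
        real_of_int (max 1 a) + expectation (\<lambda>\<omega>. real (num_arrived \<xi> L 0 \<omega>))) at_top"
      by (rule expectation_cond_limit[OF alpha_event[OF order_refl] pos, where a = a])
        (use ev in \<open>auto elim!: eventually_mono\<close>)
  qed
  have c_ae: "\<P>(\<omega> in M. n j \<omega> = k) = \<P>(\<omega> in M. int (num_arrived \<xi> L 0 \<omega>) = int k - a)"
    if "j0 \<le> J" "a > 0" "AE \<omega> in M. alpha \<xi> L n J \<omega> = a" "J \<le> j" for J a j k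
    by (rule delayed_queue.prob_queue_of_alpha_pos[OF delayed_queue_later[OF that(1)] that(3,2,4)])
  have c_ge: "AE \<omega> in M. alpha \<xi> L n J \<omega> = a \<longrightarrow> (\<forall>j\<ge>J. int (n j \<omega>) \<ge> a)"
    if "j0 \<le> J" "a > 0" for J a
    by (rule delayed_queue.AE_queue_ge[OF delayed_queue_later[OF that(1)] that(2)])
  show ?thesis
    apply (intro conjI)
    subgoal by (rule AE_num_arrivals)
    subgoal by (rule AE_queue_Suc)
    subgoal by (rule AE_alpha_Suc)
    subgoal by (rule AE_alpha_busy_period)
    subgoal using num_arrived_measurable distr_num_arrived_eq by blast
    subgoal by (rule AE_alpha_pos)
    subgoal using expectation_queue_of_alpha_pos by blast
    subgoal using AE_zeros[OF empty] b by blast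
    subgoal using c_ae c c_ge by blast
    subgoal using law by blast
    done
qed

end
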